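(* Let $t>0$. Then the distribution of $h_1(X_1,\ldots,X_n)-h_0(X_1,\ldots,X_n)$ under $\mathbb{P}_{0,t}$ equals its distribution under $\mathbb{P}_{0,1}$, that is, $$\mathbb{P}_{0,t}\big(h_1(X_1,\ldots,X_n)-h_0(X_1,\ldots,X_n)\in\cdot\big)=\mathbb{P}_{0,1}\big(h_1(X_1,\ldots,X_n)-h_0(X_1,\ldots,X_n)\in\cdot\big).$$
   Context: Fix $d,n\in\mathbb{N}$, $\alpha>0$ and $k_1,\ldots,k_n\in\mathbb{R}^d\setminus\{0\}$ with $\{k_i,-k_i\}\cap\{k_j,-k_j\}=\emptyset$ for $i\ne j$. Put $\kappa_j:=\|k_j\|^\alpha>0$ for $j=1,\ldots,n$. The parameter space is $$\Theta:=\{(s,t)\in\mathbb{R}^2: s\ge0,\ s+t\kappa_1>0,\ldots,s+t\kappa_n>0\}.$$ For $(s,t)\in\Theta$, under the probability measure $\mathbb{P}_{s,t}$ the random variables $X_1,\ldots,X_n$ are independent and $X_j$ is exponentially distributed with mean $s+t\kappa_j$. For $(x_1,\ldots,x_n)\in(0,\infty)^n$ the log-likelihood function is $$\mathcal{L}(x_1,\ldots,x_n;s,t):=\sum_{j=1}^n\Big[-\log(s+t\kappa_j)-\frac{x_j}{s+t\kappa_j}\Big],\quad (s,t)\in\Theta,$$ and $$h_0(x_1,\ldots,x_n):=\sup\{\mathcal{L}(x_1,\ldots,x_n;0,t):(0,t)\in\Theta\},\qquad h_1(x_1,\ldots,x_n):=\sup\{\mathcal{L}(x_1,\ldots,x_n;s,t):(s,t)\in\Theta\}.$$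 *)

theory Defs
  imports "HOL-Probability.Probability"
begin

definition kappa :: "real \<Rightarrow> (nat \<Rightarrow> real ^ 'd) \<Rightarrow> nat \<Rightarrow> real" where
  "kappa \<alpha> k j = norm (k j) powr \<alpha>"

text \<open>In what follows \<open>\<kappa>\<close> and \<open>x\<close> are vectors indexed by \<open>{1..n}\<close>; their values at
  other indices are irrelevant.\<close>

definition Theta :: "nat \<Rightarrow> (nat \<Rightarrow> real) \<Rightarrow> (real \<times> real) set" where
  "Theta n \<kappa> = {(s, t). 0 \<le> s \<and> (\<forall>j\<in>{1..n}. 0 < s + t * \<kappa> j)}"

definition loglik :: "nat \<Rightarrow> (nat \<Rightarrow> real) \<Rightarrow> (nat \<Rightarrow> real) \<Rightarrow> real \<Rightarrow> real \<Rightarrow> real" where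
  "loglik n \<kappa> x s t = (\<Sum>j=1..n. - ln (s + t * \<kappa> j) - x j / (s + t * \<kappa> j))"

text \<open>The suprema are taken only at points with positive coordinates, where they range over
  nonempty sets that are bounded above: each summand satisfies
  \<open>- ln u - x j / u \<le> - ln (x j) - 1\<close> for \<open>u > 0\<close>.  Elsewhere the value is set to \<open>0\<close>; an
  exponentially distributed vector lies there with probability zero.\<close>

definition h0 :: "nat \<Rightarrow> (nat \<Rightarrow> real) \<Rightarrow> (nat \<Rightarrow> real) \<Rightarrow> real" where
  "h0 n \<kappa> x = (if \<forall>j\<in>{1..n}. 0 < x j
     then SUP t\<in>{t. (0, t) \<in> Theta n \<kappa>}. loglik n \<kappa> x 0 t else 0)"

definition h1 :: "nat \<Rightarrow> (nat \<Rightarrow> real) \<Rightarrow> (nat \<Rightarrow> real) \<Rightarrow> real" where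
  "h1 n \<kappa> x = (if \<forall>j\<in>{1..n}. 0 < x j
     then SUP (s, t)\<in>Theta n \<kappa>. loglik n \<kappa> x s t else 0)"

text \<open>The measures \<open>P s t\<close> live on one measurable space \<open>M\<close>, which carries the random variables
  \<open>X 1, \<dots>, X n\<close>.  The parameter of \<^const>\<open>exponential_density\<close> is the rate, that is, the
  reciprocal of the mean.\<close>

definition exponential_model ::
  "nat \<Rightarrow> (nat \<Rightarrow> real) \<Rightarrow> 'w measure \<Rightarrow> (real \<Rightarrow> real \<Rightarrow> 'w measure) \<Rightarrow> (nat \<Rightarrow> 'w \<Rightarrow> real) \<Rightarrow> bool"
where
  "exponential_model n \<kappa> M P X \<longleftrightarrow> (\<forall>(s, t)\<in>Theta n \<kappa>.
     prob_space (P s t) \<and> sets (P s t) = sets M \<and>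
     prob_space.indep_vars (P s t) (\<lambda>_. borel) X {1..n} \<and>
     (\<forall>j\<in>{1..n}. distributed (P s t) lborel (X j) (exponential_density (1 / (s + t * \<kappa> j)))))"

end

theory Submission
  imports Defs
begin

text \<open>The law of \<open>(X\<^sub>1, \<dots>, X\<^sub>n)\<close> under \<open>P 0 t\<close> is the law of \<open>(t X\<^sub>1, \<dots>, t X\<^sub>n)\<close> under \<open>P 0 1\<close>.
  Multiplying the data by \<open>c > 0\<close> and substituting \<open>(s, t) = (c s', c t')\<close> shifts the
  log-likelihood by \<open>- n ln c\<close>; as both parameter sets are cones, both suprema shift by this
  amount and their difference is scale invariant. Measurability of the suprema follows by
  restricting them to a countable dense set of parameters.\<close>

section \<open>Suprema of the log-likelihood\<close>

text \<open>With the parameter set as an argument, \<open>h0\<close> and \<open>h1\<close> share one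
  proof of scaling and one of measurability. The default 0 agrees with theirs.\<close>

definition max_loglik :: "nat \<Rightarrow> (nat \<Rightarrow> real) \<Rightarrow> (real \<times> real) set \<Rightarrow> (nat \<Rightarrow> real) \<Rightarrow> real" where
  "max_loglik n \<kappa> S x =
     (if \<forall>j\<in>{1..n}. 0 < x j then SUP (s, t)\<in>S. loglik n \<kappa> x s t else 0)"

lemma h1_eq_max_loglik: "h1 n \<kappa> = max_loglik n \<kappa> (Theta n \<kappa>)"
  by (simp add: fun_eq_iff h1_def max_loglik_def)

lemma h0_eq_max_loglik: "h0 n \<kappa> = max_loglik n \<kappa> (Theta n \<kappa> \<inter> {0} \<times> UNIV)"
proof -
  have "Theta n \<kappa> \<inter> {0} \<times> UNIV = Pair 0 ` {t. (0, t) \<in> Theta n \<kappa>}"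
    by auto
  then show ?thesis
    by (simp add: fun_eq_iff h0_def max_loglik_def image_image)
qed

text \<open>Allows passing between the full family \<open>X\<close> and its restriction to
  \<open>{1..n}\<close>, which is what a law on the product space sees.\<close>

lemma max_loglik_cong:
  assumes "\<And>j. j \<in> {1..n} \<Longrightarrow> x j = y j"
  shows "max_loglik n \<kappa> S x = max_loglik n \<kappa> S y"
proof -
  have "loglik n \<kappa> x = loglik n \<kappa> y"
    unfolding loglik_def fun_eq_iff using assms by (intro allI sum.cong) auto
  moreover have "(\<forall>j\<in>{1..n}. 0 < x j) \<longleftrightarrow> (\<forall>j\<in>{1..n}. 0 < y j)"
    using assms by auto
  ultimately show ?thesis
    by (simp only: max_loglik_def)
qed

text \<open>This is \<open>ln z \<le> z - 1\<close> at \<open>z = x / u\<close>. The bound is free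
  of \<open>u\<close>, hence uniform in the parameters.\<close>

lemma neg_ln_minus_divide_le:
  fixes x u :: real
  assumes "0 < x" "0 < u"
  shows "- ln u - x / u \<le> - ln x - 1"
  using ln_le_minus_one[of "x / u"] assms by (simp add: ln_div)

lemma bdd_above_loglik:
  assumes "S \<subseteq> Theta n \<kappa>" "\<forall>j\<in>{1..n}. 0 < x j"
  shows "bdd_above ((\<lambda>(s, t). loglik n \<kappa> x s t) ` S)"
proof (rule bdd_aboveI2)
  fix p assume "p \<in> S"
  with assms show "(\<lambda>(s, t). loglik n \<kappa> x s t) p \<le> (\<Sum>j=1..n. - ln (x j) - 1)"
    by (auto simp: loglik_def Theta_def split: prod.split
             intro!: sum_mono neg_ln_minus_divide_le)
qed

section \<open>Behaviour under scaling of the data\<close>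

lemma loglik_scale:
  assumes "0 < c" "(s, t) \<in> Theta n \<kappa>"
  shows "loglik n \<kappa> (\<lambda>j. c * x j) s t = loglik n \<kappa> x (s / c) (t / c) - n * ln c"
proof -
  have "- ln (s + t * \<kappa> j) - c * x j / (s + t * \<kappa> j)
      = (- ln (s / c + t / c * \<kappa> j) - x j / (s / c + t / c * \<kappa> j)) - ln c"
    if "j \<in> {1..n}" for j
  proof -
    have pos: "0 < s + t * \<kappa> j"
      using assms that by (auto simp: Theta_def)
    have eq: "s / c + t / c * \<kappa> j = (s + t * \<kappa> j) / c"
      by (simp add: add_divide_distrib)
    show ?thesis
      unfolding eq using pos assms(1) by (simp add: ln_div)
  qed
  then have "loglik n \<kappa> (\<lambda>j. c * x j) s t
      = (\<Sum>j=1..n. (- ln (s / c + t / c * \<kappa> j) - x j / (s / c + t / c * \<kappa> j)) - ln c)"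
    unfolding loglik_def by (intro sum.cong) auto
  then show ?thesis
    by (simp add: loglik_def sum_subtractf)
qed

lemma max_loglik_scale:
  assumes S: "S \<subseteq> Theta n \<kappa>" "S \<noteq> {}"
    and cone: "\<And>c s t. 0 < c \<Longrightarrow> (s, t) \<in> S \<Longrightarrow> (c * s, c * t) \<in> S"
    and c: "0 < c" and x: "\<forall>j\<in>{1..n}. 0 < x j"
  shows "max_loglik n \<kappa> S (\<lambda>j. c * x j) = max_loglik n \<kappa> S x - n * ln c"
proof -
  \<comment> \<open>One inequality suffices if it is proved for all factors and all positive data:
    applied with factor \<open>1 / c\<close> to the data \<open>c * x j\<close>, it gives the
    converse.\<close>
  have le: "max_loglik n \<kappa> S (\<lambda>j. c * x j) \<le> max_loglik n \<kappa> S x - n * ln c"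
    if c: "0 < c" and x: "\<forall>j\<in>{1..n}. 0 < x j" for c x
  proof -
    have "(\<lambda>(s, t). loglik n \<kappa> (\<lambda>j. c * x j) s t) p
        \<le> (SUP (s, t)\<in>S. loglik n \<kappa> x s t) - n * ln c" if "p \<in> S" for p
    proof -
      obtain s t where p: "p = (s, t)" by fastforce
      have "(s / c, t / c) \<in> S"
        using cone[of "1 / c" s t] c that p by simp
      from cSUP_upper[OF this bdd_above_loglik[OF S(1) x]] show ?thesis
        using loglik_scale[OF c, of s t n \<kappa> x] S(1) that p by auto
    qed
    then have "(SUP (s, t)\<in>S. loglik n \<kappa> (\<lambda>j. c * x j) s t)
        \<le> (SUP (s, t)\<in>S. loglik n \<kappa> x s t) - n * ln c"
      by (intro cSUP_least S(2))
    then show ?thesis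
      using c x by (simp add: max_loglik_def)
  qed
  have "max_loglik n \<kappa> S (\<lambda>j. 1 / c * (c * x j))
      \<le> max_loglik n \<kappa> S (\<lambda>j. c * x j) - n * ln (1 / c)"
    using c x by (intro le) auto
  with le[OF c x] c show ?thesis
    by (simp add: ln_div)
qed

lemma h1_minus_h0_scale:
  assumes \<kappa>: "\<forall>j\<in>{1..n}. 0 < \<kappa> j" and c: "0 < c"
  shows "h1 n \<kappa> (\<lambda>j. c * x j) - h0 n \<kappa> (\<lambda>j. c * x j) = h1 n \<kappa> x - h0 n \<kappa> x"
proof (cases "\<forall>j\<in>{1..n}. 0 < x j")
  case True
  have cone: "(a * s, a * t) \<in> Theta n \<kappa>" if "0 < a" "(s, t) \<in> Theta n \<kappa>" for a s t
  proof -
    have "0 < a * (s + t * \<kappa> j)" if "j \<in> {1..n}" for j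
      using \<open>0 < a\<close> \<open>(s, t) \<in> Theta n \<kappa>\<close> that by (auto simp: Theta_def)
    with that show ?thesis
      by (auto simp: Theta_def algebra_simps)
  qed
  \<comment> \<open>This point lies in both parameter sets, so both suprema range over nonempty
    sets.\<close>
  have ne: "(0, 1) \<in> Theta n \<kappa>"
    using \<kappa> by (auto simp: Theta_def)
  have "h1 n \<kappa> (\<lambda>j. c * x j) = h1 n \<kappa> x - n * ln c"
    unfolding h1_eq_max_loglik using ne cone c True by (intro max_loglik_scale) auto
  moreover have "h0 n \<kappa> (\<lambda>j. c * x j) = h0 n \<kappa> x - n * ln c"
    unfolding h0_eq_max_loglik using ne cone[where s = 0] c True
    by (intro max_loglik_scale) auto
  ultimately show ?thesis by simp
next
  case False
  \<comment> \<open>A positive factor preserves signs, so all four terms take the default value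
    0.\<close>
  with c have "\<not> (\<forall>j\<in>{1..n}. 0 < c * x j)"
    by (simp add: zero_less_mult_iff)
  with False show ?thesis
    by (simp only: h1_def h0_def if_False)
qed

section \<open>Measurability of the suprema\<close>

text \<open>On \<open>Theta\<close> all denominators are positive, so \<open>loglik\<close> is
  continuous in the parameters and its value at a point of \<open>S\<close> is a limit of values on
  \<open>T\<close>.\<close>

lemma SUP_loglik_dense:
  assumes T: "T \<subseteq> S" "S \<subseteq> closure T" "S \<noteq> {}" and S: "S \<subseteq> Theta n \<kappa>"
    and x: "\<forall>j\<in>{1..n}. 0 < x j"
  shows "(SUP (s, t)\<in>S. loglik n \<kappa> x s t) = (SUP (s, t)\<in>T. loglik n \<kappa> x s t)"
    (is "Sup (?L ` S) = Sup (?L ` T)")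
proof (rule antisym)
  have bdd: "bdd_above (?L ` S)" "bdd_above (?L ` T)"
    using S T x by (auto intro!: bdd_above_loglik)
  have "T \<noteq> {}"
    using T by auto
  then show "Sup (?L ` T) \<le> Sup (?L ` S)"
    using bdd T by (intro cSUP_subset_mono) auto
  show "Sup (?L ` S) \<le> Sup (?L ` T)"
  proof (rule cSUP_least[OF T(3)])
    fix p assume "p \<in> S"
    then obtain q where q: "\<And>m. q m \<in> T" "q \<longlonglongrightarrow> p"
      using T(2) closure_sequential by blast
    have pos: "0 < fst p + snd p * \<kappa> j" if "j \<in> {1..n}" for j
      using S \<open>p \<in> S\<close> that by (auto simp: Theta_def)
    have "(\<lambda>m. ?L (q m)) \<longlonglongrightarrow> ?L p"
      unfolding loglik_def case_prod_beta
      using pos by (intro tendsto_intros q(2)) force+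
    moreover have "?L (q m) \<le> Sup (?L ` T)" for m
      using q(1) bdd(2) by (intro cSUP_upper)
    ultimately show "?L p \<le> Sup (?L ` T)"
      by (intro LIMSEQ_le_const2) auto
  qed
qed

lemma borel_measurable_max_loglik:
  assumes S: "S \<subseteq> Theta n \<kappa>" "S \<noteq> {}"
  shows "max_loglik n \<kappa> S \<in> borel_measurable (Pi\<^sub>M {1..n} (\<lambda>_. borel))"
proof -
  \<comment> \<open>The plane is second countable, so each of its subsets has a countable dense
    subset.\<close>
  obtain T where T: "countable T" "T \<subseteq> S" "S \<subseteq> closure T"
    using separable by blast
  have "T \<noteq> {}"
    using S T by auto
  \<comment> \<open>The case distinction moves inside the supremum. As \<open>T\<close> is nonempty,
    the supremum of the constant 0 is 0, so \<open>eq\<close> holds for every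
    \<open>x\<close>.\<close>
  define F where "F = (\<lambda>p x. if \<forall>j\<in>{1..n}. 0 < x j then loglik n \<kappa> x (fst p) (snd p) else 0)"
  have eq: "max_loglik n \<kappa> S x = (SUP p\<in>T. F p x)" for x
    using SUP_loglik_dense[OF T(2,3) S(2,1)] \<open>T \<noteq> {}\<close>
    by (simp add: max_loglik_def F_def case_prod_beta)
  have meas: "F p \<in> borel_measurable (Pi\<^sub>M {1..n} (\<lambda>_. borel))" for p
    unfolding F_def loglik_def by measurable
  have bdd: "bdd_above ((\<lambda>p. F p x) ` T)" for x
    using bdd_above_loglik[of T n \<kappa> x] S(1) T(2) unfolding F_def
    by (auto simp: case_prod_beta)
  show ?thesis
    unfolding eq[abs_def] using T(1) meas bdd by (intro borel_measurable_cSUP) auto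
qed

lemma borel_measurable_h1_minus_h0:
  assumes "\<forall>j\<in>{1..n}. 0 < \<kappa> j"
  shows "(\<lambda>x. h1 n \<kappa> x - h0 n \<kappa> x) \<in> borel_measurable (Pi\<^sub>M {1..n} (\<lambda>_. borel))"
proof -
  have "(0, 1) \<in> Theta n \<kappa>"
    using assms by (auto simp: Theta_def)
  then show ?thesis
    unfolding h1_eq_max_loglik h0_eq_max_loglik
    by (intro borel_measurable_diff borel_measurable_max_loglik) auto
qed

section \<open>Scaling of exponential laws\<close>

text \<open>An affine change of variables with shift 0: multiplying the variable by \<open>c\<close>
  divides the rate by \<open>c\<close>.\<close>

lemma (in prob_space) exponential_distributed_scale:
  assumes X: "distributed M lborel X (exponential_density l)" and c: "0 < c"
  shows "distributed M lborel (\<lambda>\<omega>. c * X \<omega>) (exponential_density (l / c))"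
proof -
  have "(\<lambda>x. ennreal (exponential_density l ((x - 0) / c)) / ennreal \<bar>c\<bar>)
      = (\<lambda>x. ennreal (exponential_density (l / c) x))"
  proof
    fix x
    show "ennreal (exponential_density l ((x - 0) / c)) / ennreal \<bar>c\<bar>
        = ennreal (exponential_density (l / c) x)"
    proof (cases "0 \<le> l")
      case True
      then show ?thesis
        using c by (simp add: exponential_density_def divide_less_0_iff divide_ennreal)
    next
      case False
      \<comment> \<open>For a negative rate both formulas are nonpositive, and
        \<open>ennreal\<close> truncates them to 0.\<close>
      then have "exponential_density l (x / c) \<le> 0" "exponential_density (l / c) x \<le> 0"
        using c by (auto simp: exponential_density_def mult_nonpos_nonneg divide_nonpos_pos)
      then show ?thesis
        by (simp add: ennreal_neg)
    qed
  qed
  with distributed_affine[OF X, of c 0] c show ?thesis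
    by simp
qed

text \<open>Independence turns each joint law into the product of its marginals; this
  characterisation is applied for nonempty \<open>I\<close>.\<close>

lemma distr_restrict_eq_of_marginals:
  assumes P: "prob_space P" "prob_space.indep_vars P (\<lambda>_. borel) X I"
    and Q: "prob_space Q" "prob_space.indep_vars Q (\<lambda>_. borel) Y I"
    and I: "I \<noteq> {}"
    and eq: "\<And>i. i \<in> I \<Longrightarrow> distr P borel (X i) = distr Q borel (Y i)"
  shows "distr P (Pi\<^sub>M I (\<lambda>_. borel)) (\<lambda>\<omega>. \<lambda>i\<in>I. X i \<omega>)
       = distr Q (Pi\<^sub>M I (\<lambda>_. borel)) (\<lambda>\<omega>. \<lambda>i\<in>I. Y i \<omega>)"
proof -
  interpret P: prob_space P by fact
  interpret Q: prob_space Q by fact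
  have "distr P (Pi\<^sub>M I (\<lambda>_. borel)) (\<lambda>\<omega>. \<lambda>i\<in>I. X i \<omega>) = (\<Pi>\<^sub>M i\<in>I. distr P borel (X i))"
    using P.indep_vars_iff_distr_eq_PiM'[OF I, where M' = "\<lambda>_. borel" and X = X] P(2)
    by (auto simp: P.indep_vars_def)
  also have "\<dots> = (\<Pi>\<^sub>M i\<in>I. distr Q borel (Y i))"
    using eq by (intro PiM_cong) auto
  also have "\<dots> = distr Q (Pi\<^sub>M I (\<lambda>_. borel)) (\<lambda>\<omega>. \<lambda>i\<in>I. Y i \<omega>)"
    using Q.indep_vars_iff_distr_eq_PiM'[OF I, where M' = "\<lambda>_. borel" and X = Y] Q(2)
    by (auto simp: Q.indep_vars_def)
  finally show ?thesis .
qed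

text \<open>Both \<open>X j\<close> under \<open>P 0 t\<close> and \<open>t * X j\<close> under
  \<open>P 0 1\<close> are exponential with mean \<open>t * \<kappa> j\<close>, and independence
  survives coordinatewise scaling.\<close>

lemma distr_exponential_model_eq:
  assumes model: "exponential_model n \<kappa> M P X"
    and \<kappa>: "\<forall>j\<in>{1..n}. 0 < \<kappa> j" and t: "0 < t" and n: "n \<noteq> 0"
  shows "distr (P 0 t) (Pi\<^sub>M {1..n} (\<lambda>_. borel)) (\<lambda>\<omega>. \<lambda>j\<in>{1..n}. X j \<omega>)
       = distr (P 0 1) (Pi\<^sub>M {1..n} (\<lambda>_. borel)) (\<lambda>\<omega>. \<lambda>j\<in>{1..n}. t * X j \<omega>)"
proof (rule distr_restrict_eq_of_marginals)
  have "(0, t) \<in> Theta n \<kappa>" "(0, 1) \<in> Theta n \<kappa>"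
    using \<kappa> t by (auto simp: Theta_def)
  then have Pt: "prob_space (P 0 t)" "prob_space.indep_vars (P 0 t) (\<lambda>_. borel) X {1..n}"
      "\<And>j. j \<in> {1..n} \<Longrightarrow> distributed (P 0 t) lborel (X j) (exponential_density (1 / (t * \<kappa> j)))"
    and P1: "prob_space (P 0 1)" "prob_space.indep_vars (P 0 1) (\<lambda>_. borel) X {1..n}"
      "\<And>j. j \<in> {1..n} \<Longrightarrow> distributed (P 0 1) lborel (X j) (exponential_density (1 / \<kappa> j))"
    using model unfolding exponential_model_def by fastforce+
  show "prob_space (P 0 t)" "prob_space.indep_vars (P 0 t) (\<lambda>_. borel) X {1..n}"
    "prob_space (P 0 1)" by fact+
  show "prob_space.indep_vars (P 0 1) (\<lambda>_. borel) (\<lambda>j \<omega>. t * X j \<omega>) {1..n}"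
    using P1 by (intro prob_space.indep_vars_compose2[where Y = "\<lambda>_ x. t * x"]) auto
  show "{1..n} \<noteq> {}"
    using n by auto
  fix j assume j: "j \<in> {1..n}"
  have "distr (P 0 t) lborel (X j) = distr (P 0 1) lborel (\<lambda>\<omega>. t * X j \<omega>)"
    using distributed_distr_eq_density[OF Pt(3)[OF j]]
      distributed_distr_eq_density[OF prob_space.exponential_distributed_scale[OF P1(1) P1(3)[OF j] t]]
    by (simp add: mult.commute)
  \<comment> \<open>The target measure enters \<open>distr\<close> only through its sigma-algebra,
    which is the same for \<open>lborel\<close> and \<open>borel\<close>.\<close>
  then show "distr (P 0 t) borel (X j) = distr (P 0 1) borel (\<lambda>\<omega>. t * X j \<omega>)"
    by (simp cong: distr_cong)
qed

section \<open>Law of the log-likelihood ratio\<close>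

lemma distr_h1_minus_h0_exponential_model:
  assumes model: "exponential_model n \<kappa> M P X"
    and \<kappa>: "\<forall>j\<in>{1..n}. 0 < \<kappa> j" and t: "0 < t"
  shows "distr (P 0 t) borel (\<lambda>\<omega>. h1 n \<kappa> (\<lambda>j. X j \<omega>) - h0 n \<kappa> (\<lambda>j. X j \<omega>))
       = distr (P 0 1) borel (\<lambda>\<omega>. h1 n \<kappa> (\<lambda>j. X j \<omega>) - h0 n \<kappa> (\<lambda>j. X j \<omega>))"
proof -
  define D where "D x = h1 n \<kappa> x - h0 n \<kappa> x" for x
  have D_cong: "D x = D y" if "\<And>j. j \<in> {1..n} \<Longrightarrow> x j = y j" for x y
    unfolding D_def h1_eq_max_loglik h0_eq_max_loglik using max_loglik_cong[OF that] by simp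
  have "(0, t) \<in> Theta n \<kappa>" "(0, 1) \<in> Theta n \<kappa>"
    using \<kappa> t by (auto simp: Theta_def)
  then have prob: "prob_space (P 0 t)" "prob_space (P 0 1)"
    and indep: "prob_space.indep_vars (P 0 t) (\<lambda>_. borel) X {1..n}"
      "prob_space.indep_vars (P 0 1) (\<lambda>_. borel) X {1..n}"
    using model unfolding exponential_model_def by fastforce+
  have "distr (P 0 t) borel (\<lambda>\<omega>. D (\<lambda>j. X j \<omega>)) = distr (P 0 1) borel (\<lambda>\<omega>. D (\<lambda>j. X j \<omega>))"
  proof (cases "n = 0")
    case True
    \<comment> \<open>Without coordinates \<open>D\<close> is constant, so both laws are the same
      point mass. The product argument below has a nonempty index set.\<close>
    then have const: "D x = D (\<lambda>_. 0)" for x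
      by (intro D_cong) auto
    show ?thesis
      using prob by (subst (1 2) const) (simp add: prob_space.distr_const)
  next
    case False
    let ?B = "Pi\<^sub>M {1..n} (\<lambda>_. borel :: real measure)"
    have D: "D \<in> borel_measurable ?B"
      using borel_measurable_h1_minus_h0[OF \<kappa>] by (simp add: D_def[abs_def])
    have X: "X j \<in> borel_measurable (P 0 t)" "X j \<in> borel_measurable (P 0 1)"
      if "j \<in> {1..n}" for j
      using indep prob that by (auto simp: prob_space.indep_vars_def)
    \<comment> \<open>Restriction puts the vector into the product space, where \<open>D\<close> is
      measurable, without changing the value of \<open>D\<close>.\<close>
    have "distr (P 0 t) borel (\<lambda>\<omega>. D (\<lambda>j. X j \<omega>))
        = distr (P 0 t) borel (D \<circ> (\<lambda>\<omega>. \<lambda>j\<in>{1..n}. X j \<omega>))"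
      by (intro distr_cong) (auto intro!: D_cong)
    also have "\<dots> = distr (distr (P 0 t) ?B (\<lambda>\<omega>. \<lambda>j\<in>{1..n}. X j \<omega>)) borel D"
      using X by (intro distr_distr[symmetric] D measurable_restrict)
    also have "\<dots> = distr (distr (P 0 1) ?B (\<lambda>\<omega>. \<lambda>j\<in>{1..n}. t * X j \<omega>)) borel D"
      by (simp only: distr_exponential_model_eq[OF model \<kappa> t False])
    also have "\<dots> = distr (P 0 1) borel (D \<circ> (\<lambda>\<omega>. \<lambda>j\<in>{1..n}. t * X j \<omega>))"
      using X by (intro distr_distr D measurable_restrict borel_measurable_times) auto
    also have "\<dots> = distr (P 0 1) borel (\<lambda>\<omega>. D (\<lambda>j. t * X j \<omega>))"
      by (intro distr_cong) (auto intro!: D_cong)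
    \<comment> \<open>Scale invariance of \<open>D\<close> removes the factor
      \<open>t\<close>.\<close>
    also have "\<dots> = distr (P 0 1) borel (\<lambda>\<omega>. D (\<lambda>j. X j \<omega>))"
      using h1_minus_h0_scale[OF \<kappa> t] by (simp add: D_def)
    finally show ?thesis .
  qed
  then show ?thesis
    by (simp add: D_def)
qed

theorem lemma6p2:
  fixes n :: nat and \<alpha> t :: real and k :: "nat \<Rightarrow> real ^ 'd"
    and M :: "'w measure" and P :: "real \<Rightarrow> real \<Rightarrow> 'w measure" and X :: "nat \<Rightarrow> 'w \<Rightarrow> real"
  assumes "\<alpha> > 0"
    and "\<forall>j\<in>{1..n}. k j \<noteq> 0"
    and "\<forall>i\<in>{1..n}. \<forall>j\<in>{1..n}. i \<noteq> j \<longrightarrow> {k i, - k i} \<inter> {k j, - k j} = {}"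
    and "exponential_model n (kappa \<alpha> k) M P X"
    and "t > 0"
  shows "distr (P 0 t) borel
           (\<lambda>\<omega>. h1 n (kappa \<alpha> k) (\<lambda>j. X j \<omega>) - h0 n (kappa \<alpha> k) (\<lambda>j. X j \<omega>))
       = distr (P 0 1) borel
           (\<lambda>\<omega>. h1 n (kappa \<alpha> k) (\<lambda>j. X j \<omega>) - h0 n (kappa \<alpha> k) (\<lambda>j. X j \<omega>))"
proof -
  have "\<forall>j\<in>{1..n}. 0 < kappa \<alpha> k j"
    using assms(2) by (simp add: kappa_def)
  then show ?thesis
    using assms(4,5) by (intro distr_h1_minus_h0_exponential_model)
qed

end
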